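(* Let $(X,d)$ be a complete $b$-metric space and let $f:X\to X$ be a continuous function. Suppose that there exist an integer $m\ge 1$ and a comparison function $\varphi:[0,\infty)\to[0,\infty)$ such that $$d(f^{[m]}(x),f^{[m]}(y))\le \varphi\big(\max\{d(x,y),\,d(f(x),f(y)),\dots,d(f^{[m-1]}(x),f^{[m-1]}(y))\}\big)$$ for all $x,y\in X$. Then $f$ is a Picard operator.
   Context: Given a nonempty set $X$ and a real number $s\in[1,\infty)$, a function $d:X\times X\to[0,\infty)$ is a $b$-metric (with constant $s$) if for all $x,y,z\in X$: (i) $d(x,y)=0$ if and only if $x=y$; (ii) $d(x,y)=d(y,x)$; (iii) $d(x,y)\le s(d(x,z)+d(z,y))$. The pair $(X,d)$ is then called a $b$-metric space (with constant $s$). The function $d$ is not assumed to be continuous. A sequence $(x_n)$ in $X$ is convergent if there is $l\in X$ with $\lim_{n\to\infty}d(x_n,l)=0$ (then $(x_n)$ converges to $l$); it is Cauchy if for every $\varepsilon>0$ there is $n_\varepsilon$ with $d(x_m,x_n)<\varepsilon$ for all $m,n\ge n_\varepsilon$. The space $(X,d)$ is complete if every Cauchy sequence is convergent. $X$ is endowed with the topology induced by this convergence; continuity of $f:X\to X$ amounts to: $d(x_n,x)\to 0$ implies $d(f(x_n),f(x))\to 0$. For $f:X\to X$ and $n\in\mathbb{N}$, $f^{[n]}$ denotes the $n$-fold composition of $f$ with itself ($f^{[0]}=\mathrm{id}$). A comparison function is a function $\varphi:[0,\infty)\to[0,\infty)$ that is increasing (in the weak sense: $r\le t$ implies $\varphi(r)\le\varphi(t)$)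 and satisfies $\lim_{n\to\infty}\varphi^{[n]}(r)=0$ for every $r\in[0,\infty)$. A function $f:X\to X$ is a Picard operator if there is a unique fixed point $\alpha$ of $f$ and, for every $x\in X$, the sequence $(f^{[n]}(x))_{n\in\mathbb{N}}$ converges to $\alpha$. *)

theory Defs
  imports "HOL-Analysis.Analysis"
begin

locale b_metric_space =
  fixes X :: "'a set" and d :: "'a \<Rightarrow> 'a \<Rightarrow> real" and s :: real
  assumes nonempty: "X \<noteq> {}"
    and const_ge_1: "1 \<le> s"
    and nonneg: "\<And>x y. x \<in> X \<Longrightarrow> y \<in> X \<Longrightarrow> 0 \<le> d x y"
    and zero_iff: "\<And>x y. x \<in> X \<Longrightarrow> y \<in> X \<Longrightarrow> d x y = 0 \<longleftrightarrow> x = y"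
    and commute: "\<And>x y. x \<in> X \<Longrightarrow> y \<in> X \<Longrightarrow> d x y = d y x"
    and b_triangle:
      "\<And>x y z. x \<in> X \<Longrightarrow> y \<in> X \<Longrightarrow> z \<in> X \<Longrightarrow> d x y \<le> s * (d x z + d z y)"

definition b_converges_to ::
    "'a set \<Rightarrow> ('a \<Rightarrow> 'a \<Rightarrow> real) \<Rightarrow> (nat \<Rightarrow> 'a) \<Rightarrow> 'a \<Rightarrow> bool" where
  "b_converges_to X d u l \<longleftrightarrow>
     range u \<subseteq> X \<and> l \<in> X \<and> (\<lambda>n. d (u n) l) \<longlonglongrightarrow> 0"

definition b_Cauchy :: "'a set \<Rightarrow> ('a \<Rightarrow> 'a \<Rightarrow> real) \<Rightarrow> (nat \<Rightarrow> 'a) \<Rightarrow> bool" where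
  "b_Cauchy X d u \<longleftrightarrow>
     range u \<subseteq> X \<and> (\<forall>\<epsilon>>0. \<exists>N. \<forall>m\<ge>N. \<forall>n\<ge>N. d (u m) (u n) < \<epsilon>)"

definition b_complete :: "'a set \<Rightarrow> ('a \<Rightarrow> 'a \<Rightarrow> real) \<Rightarrow> bool" where
  "b_complete X d \<longleftrightarrow> (\<forall>u. b_Cauchy X d u \<longrightarrow> (\<exists>l. b_converges_to X d u l))"

(* The topology of a b-metric space is the one induced by convergence of sequences,
   so continuity is sequential continuity; d itself need not be continuous. *)
definition b_continuous :: "'a set \<Rightarrow> ('a \<Rightarrow> 'a \<Rightarrow> real) \<Rightarrow> ('a \<Rightarrow> 'a) \<Rightarrow> bool" where
  "b_continuous X d f \<longleftrightarrow>
     (\<forall>u x. b_converges_to X d u x \<longrightarrow> b_converges_to X d (\<lambda>n. f (u n)) (f x))"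

(* A function [0,\<infinity>) \<rightarrow> [0,\<infinity>) is a total function on the reals of which
   only the values on {0..} are constrained. *)
definition comparison_function :: "(real \<Rightarrow> real) \<Rightarrow> bool" where
  "comparison_function \<phi> \<longleftrightarrow>
     \<phi> \<in> {0..} \<rightarrow> {0..} \<and> mono_on {0..} \<phi> \<and> (\<forall>r\<ge>0. (\<lambda>n. (\<phi> ^^ n) r) \<longlonglongrightarrow> 0)"

definition Picard_operator :: "'a set \<Rightarrow> ('a \<Rightarrow> 'a \<Rightarrow> real) \<Rightarrow> ('a \<Rightarrow> 'a) \<Rightarrow> bool" where
  "Picard_operator X d f \<longleftrightarrow>
     (\<exists>\<alpha>\<in>X. f \<alpha> = \<alpha> \<and> (\<forall>\<beta>\<in>X. f \<beta> = \<beta> \<longrightarrow> \<beta> = \<alpha>) \<and>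
        (\<forall>x\<in>X. b_converges_to X d (\<lambda>n. (f ^^ n) x) \<alpha>))"

end

theory Submission
  imports Defs
begin

text \<open>
  The function \<open>\<Delta> x y = Max {d (f\<^sup>i x) (f\<^sup>i y) | i < m}\<close> again satisfies the relaxed triangle inequality,
  it does not increase under \<open>f\<close>, and \<open>\<Delta> (f\<^sup>m x) (f\<^sup>m y) \<le> \<phi> (\<Delta> x y)\<close>. Hence
  \<open>\<Delta> (f\<^sup>n x) (f\<^sup>n y)\<close> tends to 0 for all \<open>x\<close>, \<open>y\<close>. Given \<open>\<epsilon>\<close>, choose \<open>k\<close> with
  \<open>\<phi>\<^sup>k \<epsilon> < \<epsilon> / (2 s)\<close>: far out in an orbit, the iterate \<open>f\<^sup>k\<^sup>m\<close> moves its points by less than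
  \<open>\<epsilon> / (2 s)\<close> and therefore maps \<open>\<epsilon>\<close>-balls around points of the orbit into themselves. So orbits
  are Cauchy, their limits are fixed points by continuity, and all orbits have the same limit.
\<close>

section \<open>Comparison functions\<close>

lemma comparison_function_funpow_mono:
  assumes "comparison_function \<phi>" "0 \<le> r" "r \<le> t"
  shows "(\<phi> ^^ n) r \<le> (\<phi> ^^ n) t"
proof -
  have nn: "0 \<le> \<phi> u" if "0 \<le> u" for u
    using assms(1) that by (auto simp: comparison_function_def)
  have mono: "\<phi> u \<le> \<phi> v" if "0 \<le> u" "u \<le> v" for u v
    using assms(1) that by (auto simp: comparison_function_def mono_on_def)
  have pos: "0 \<le> (\<phi> ^^ n) u" if "0 \<le> u" for u n
    using that by (induction n) (auto intro: nn)
  show ?thesis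
    using assms(2,3) by (induction n) (auto intro: mono pos)
qed

text \<open>If \<open>\<phi> r\<close> exceeded \<open>r\<close>, monotonicity would keep all
  iterates from the first on above the positive number \<open>\<phi> r\<close>, so they could not
  tend to 0.\<close>

lemma comparison_function_le:
  assumes "comparison_function \<phi>" "0 \<le> r"
  shows "\<phi> r \<le> r"
proof (rule ccontr)
  assume "\<not> \<phi> r \<le> r"
  have "r \<le> (\<phi> ^^ n) r" for n
  proof (induction n)
    case (Suc n)
    have "\<phi> r \<le> \<phi> ((\<phi> ^^ n) r)"
      using comparison_function_funpow_mono[OF assms Suc, of 1] by simp
    with \<open>\<not> \<phi> r \<le> r\<close> show ?case by simp
  qed simp
  then have ge: "\<phi> r \<le> (\<phi> ^^ Suc n) r" for n
    using comparison_function_funpow_mono[OF assms, of _ 1] by simp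
  have "(\<lambda>n. (\<phi> ^^ Suc n) r) \<longlonglongrightarrow> 0"
    using assms by (intro LIMSEQ_Suc) (simp add: comparison_function_def)
  then have "\<phi> r \<le> 0"
    by (rule LIMSEQ_le_const) (use ge in blast)
  with \<open>\<not> \<phi> r \<le> r\<close> assms(2) show False by linarith
qed

text \<open>As \<open>d\<close> may be discontinuous, \<open>d a b\<close> is not obtained as a
  limit of distances; the relaxed triangle inequality through \<open>u n\<close> bounds it by a null
  sequence.\<close>

lemma (in b_metric_space) b_converges_to_unique:
  assumes "b_converges_to X d u a" "b_converges_to X d u b"
  shows "a = b"
proof -
  have X: "u n \<in> X" "a \<in> X" "b \<in> X" for n
    using assms by (auto simp: b_converges_to_def)
  have "(\<lambda>n. s * (d (u n) a + d (u n) b)) \<longlonglongrightarrow> s * (0 + 0)"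
    using assms by (intro tendsto_intros) (auto simp: b_converges_to_def)
  moreover have "d a b \<le> s * (d (u n) a + d (u n) b)" for n
    using b_triangle[of a b "u n"] commute[of a "u n"] X by simp
  ultimately have "d a b \<le> 0"
    by (intro LIMSEQ_le_const[where X = "\<lambda>n. s * (d (u n) a + d (u n) b)"]) auto
  then show ?thesis
    using nonneg[of a b] zero_iff[of a b] X by simp
qed

section \<open>Maximal distance over m consecutive iterates\<close>

locale b_max_contraction = b_metric_space +
  fixes f :: "'a \<Rightarrow> 'a" and m :: nat and \<phi> :: "real \<Rightarrow> real"
  assumes f_in: "f \<in> X \<rightarrow> X"
    and m_ge_1: "1 \<le> m"
    and comparison: "comparison_function \<phi>"
    and contraction: "\<And>x y. x \<in> X \<Longrightarrow> y \<in> X \<Longrightarrow>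
      d ((f ^^ m) x) ((f ^^ m) y) \<le> \<phi> (Max ((\<lambda>i. d ((f ^^ i) x) ((f ^^ i) y)) ` {..<m}))"
begin

definition \<Delta> :: "'a \<Rightarrow> 'a \<Rightarrow> real" where
  "\<Delta> x y = Max ((\<lambda>i. d ((f ^^ i) x) ((f ^^ i) y)) ` {..<m})"

lemma funpow_in: "x \<in> X \<Longrightarrow> (f ^^ n) x \<in> X"
  using f_in by (induction n) auto

lemma dist_le_\<Delta>: "i < m \<Longrightarrow> d ((f ^^ i) x) ((f ^^ i) y) \<le> \<Delta> x y"
  unfolding \<Delta>_def by (intro Max_ge) auto

lemma \<Delta>_le: "(\<And>i. i < m \<Longrightarrow> d ((f ^^ i) x) ((f ^^ i) y) \<le> c) \<Longrightarrow> \<Delta> x y \<le> c"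
  \<comment> \<open>\<open>1 \<le> m\<close> makes the index set nonempty, so that
    \<open>Max\<close> is a genuine maximum.\<close>
  unfolding \<Delta>_def using m_ge_1 by (intro Max.boundedI) (auto simp: lessThan_empty_iff)

lemma d_le_\<Delta>: "d x y \<le> \<Delta> x y"
  using dist_le_\<Delta>[of 0 x y] m_ge_1 by simp

lemma \<Delta>_nonneg: "x \<in> X \<Longrightarrow> y \<in> X \<Longrightarrow> 0 \<le> \<Delta> x y"
  using d_le_\<Delta>[of x y] nonneg[of x y] by simp

lemma \<Delta>_triangle:
  assumes "x \<in> X" "y \<in> X" "z \<in> X"
  shows "\<Delta> x y \<le> s * (\<Delta> x z + \<Delta> z y)"
proof (rule \<Delta>_le)
  fix i assume "i < m"
  have "d ((f ^^ i) x) ((f ^^ i) y)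
      \<le> s * (d ((f ^^ i) x) ((f ^^ i) z) + d ((f ^^ i) z) ((f ^^ i) y))"
    using assms by (intro b_triangle funpow_in)
  also have "\<dots> \<le> s * (\<Delta> x z + \<Delta> z y)"
    using const_ge_1 dist_le_\<Delta>[OF \<open>i < m\<close>] by (intro mult_left_mono add_mono) auto
  finally show "d ((f ^^ i) x) ((f ^^ i) y) \<le> s * (\<Delta> x z + \<Delta> z y)" .
qed

text \<open>Applying \<open>f\<close> shifts the window of indices by one. All entries but the last
  already occur in \<open>\<Delta> x y\<close>; the new one, of index \<open>m\<close>, is at most
  \<open>\<phi> (\<Delta> x y)\<close>, hence at most \<open>\<Delta> x y\<close>.\<close>

lemma \<Delta>_step:
  assumes "x \<in> X" "y \<in> X"
  shows "\<Delta> (f x) (f y) \<le> \<Delta> x y"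
proof (rule \<Delta>_le)
  fix i assume "i < m"
  show "d ((f ^^ i) (f x)) ((f ^^ i) (f y)) \<le> \<Delta> x y"
  proof (cases "Suc i = m")
    case True
    have "d ((f ^^ m) x) ((f ^^ m) y) \<le> \<phi> (\<Delta> x y)"
      using contraction[OF assms] by (simp add: \<Delta>_def)
    also have "\<dots> \<le> \<Delta> x y"
      by (rule comparison_function_le[OF comparison \<Delta>_nonneg[OF assms]])
    finally show ?thesis
      by (simp only: True[symmetric] funpow_Suc_right comp_apply)
  next
    case False
    then show ?thesis
      using dist_le_\<Delta>[of "Suc i" x y] \<open>i < m\<close>
      by (simp add: funpow_Suc_right del: funpow.simps)
  qed
qed

lemma \<Delta>_funpow_add_le:
  assumes "x \<in> X" "y \<in> X"
  shows "\<Delta> ((f ^^ (k + n)) x) ((f ^^ (k + n)) y) \<le> \<Delta> ((f ^^ n) x) ((f ^^ n) y)"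
proof (induction k)
  case (Suc k)
  then show ?case
    using \<Delta>_step[OF funpow_in[OF assms(1)] funpow_in[OF assms(2)], of "k + n" "k + n"] by simp
qed simp

text \<open>Each block of \<open>m\<close> steps renews the whole window and so gains one
  application of \<open>\<phi>\<close>.\<close>

lemma \<Delta>_funpow_contraction:
  assumes "x \<in> X" "y \<in> X"
  shows "\<Delta> ((f ^^ (k * m)) x) ((f ^^ (k * m)) y) \<le> (\<phi> ^^ k) (\<Delta> x y)"
proof (induction k)
  case (Suc k)
  let ?x = "(f ^^ (k * m)) x" and ?y = "(f ^^ (k * m)) y"
  have X: "?x \<in> X" "?y \<in> X" using assms by (auto intro: funpow_in)
  have mono: "\<phi> r \<le> \<phi> t" if "0 \<le> r" "r \<le> t" for r t
    using comparison_function_funpow_mono[OF comparison that, of 1] by simp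
  \<comment> \<open>Moving \<open>f ^^ m\<close> outside lets the contraction hypothesis act on the
    \<open>i\<close>-th iterates, whose \<open>\<Delta>\<close> is at most
    \<open>\<Delta> ?x ?y\<close> because \<open>\<Delta>\<close> does not increase along
    orbits.\<close>
  have commute_pow: "(f ^^ i) ((f ^^ m) z) = (f ^^ m) ((f ^^ i) z)" for i z
    by (metis add.commute comp_apply funpow_add)
  have "\<Delta> ((f ^^ m) ?x) ((f ^^ m) ?y) \<le> \<phi> (\<Delta> ?x ?y)"
  proof (rule \<Delta>_le)
    fix i
    have "d ((f ^^ m) ((f ^^ i) ?x)) ((f ^^ m) ((f ^^ i) ?y)) \<le> \<phi> (\<Delta> ((f ^^ i) ?x) ((f ^^ i) ?y))"
      using contraction[OF funpow_in funpow_in, OF X] by (simp add: \<Delta>_def)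
    also have "\<dots> \<le> \<phi> (\<Delta> ?x ?y)"
      using \<Delta>_funpow_add_le[OF X, of i 0] assms by (intro mono \<Delta>_nonneg funpow_in) auto
    finally show "d ((f ^^ i) ((f ^^ m) ?x)) ((f ^^ i) ((f ^^ m) ?y)) \<le> \<phi> (\<Delta> ?x ?y)"
      by (simp only: commute_pow)
  qed
  also have "\<dots> \<le> \<phi> ((\<phi> ^^ k) (\<Delta> x y))"
    using Suc X by (intro mono \<Delta>_nonneg) auto
  finally show ?case by (simp add: funpow_add)
qed simp

section \<open>Asymptotics of orbits and the Cauchy property\<close>

lemma comparison_tendsto: "0 \<le> r \<Longrightarrow> (\<lambda>n. (\<phi> ^^ n) r) \<longlonglongrightarrow> 0"
  using comparison by (simp add: comparison_function_def)

lemma \<Delta>_orbits_tendsto: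
  assumes "x \<in> X" "y \<in> X"
  shows "(\<lambda>n. \<Delta> ((f ^^ n) x) ((f ^^ n) y)) \<longlonglongrightarrow> 0"
proof (rule LIMSEQ_I)
  fix r :: real assume "0 < r"
  then have "\<forall>\<^sub>F k in sequentially. (\<phi> ^^ k) (\<Delta> x y) < r"
    using order_tendstoD(2)[OF comparison_tendsto[OF \<Delta>_nonneg[OF assms]]] by simp
  then obtain k where k: "(\<phi> ^^ k) (\<Delta> x y) < r"
    by (auto simp: eventually_sequentially)
  \<comment> \<open>The bound reached after \<open>k\<close> blocks persists at every later index,
    not only at multiples of \<open>m\<close>.\<close>
  have "norm (\<Delta> ((f ^^ n) x) ((f ^^ n) y) - 0) < r" if "k * m \<le> n" for n
    using \<Delta>_funpow_add_le[OF assms, of "n - k * m" "k * m"] \<Delta>_funpow_contraction[OF assms, of k]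
      \<Delta>_nonneg[OF funpow_in funpow_in, OF assms, of n n] k that by simp
  then show "\<exists>no. \<forall>n\<ge>no. norm (\<Delta> ((f ^^ n) x) ((f ^^ n) y) - 0) < r" by blast
qed

lemma orbit_Cauchy_\<Delta>:
  assumes x: "x \<in> X" and "0 < \<epsilon>"
  shows "\<exists>n0. \<forall>n\<ge>n0. \<forall>p. \<Delta> ((f ^^ n) x) ((f ^^ (n + p)) x) \<le> \<epsilon>"
proof -
  \<comment> \<open>Two legs of length \<open>\<delta>\<close> in the relaxed triangle inequality
    add up to exactly \<open>\<epsilon>\<close>.\<close>
  define \<delta> where "\<delta> = \<epsilon> / (2 * s)"
  have \<delta>: "0 < \<delta>" "s * (\<delta> + \<delta>) = \<epsilon>" "\<delta> \<le> \<epsilon>"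
    using \<open>0 < \<epsilon>\<close> const_ge_1 by (auto simp: \<delta>_def field_simps)
  \<comment> \<open>Requiring \<open>1 \<le> k\<close> makes \<open>N\<close> positive, so the
    induction below really descends from \<open>p\<close> to \<open>p - N\<close>.\<close>
  have "\<forall>\<^sub>F k in sequentially. (\<phi> ^^ k) \<epsilon> < \<delta> \<and> 1 \<le> k"
    using order_tendstoD(2)[OF comparison_tendsto \<delta>(1), of \<epsilon>] \<open>0 < \<epsilon>\<close>
    by (intro eventually_conj eventually_ge_at_top) simp
  then obtain k where k: "(\<phi> ^^ k) \<epsilon> < \<delta>" "1 \<le> k"
    by (auto simp: eventually_sequentially)
  define N where "N = k * m"
  have "0 < N" using k m_ge_1 by (simp add: N_def)
  \<comment> \<open>Only finitely many shifts \<open>r\<close> occur, so one threshold serves them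
    all. The shifts \<open>r = p \<le> N\<close> settle the base cases, and \<open>r = N\<close>
    bounds the displacement by \<open>f ^^ N\<close>.\<close>
  have "\<forall>\<^sub>F n in sequentially. \<forall>r\<in>{..N}. \<Delta> ((f ^^ n) x) ((f ^^ n) ((f ^^ r) x)) < \<delta>"
    using x \<delta> by (intro eventually_ball_finite ballI order_tendstoD(2)[OF \<Delta>_orbits_tendsto] funpow_in) auto
  then obtain n0 where n0:
    "\<And>n r. n \<ge> n0 \<Longrightarrow> r \<le> N \<Longrightarrow> \<Delta> ((f ^^ n) x) ((f ^^ (n + r)) x) < \<delta>"
    by (auto simp: eventually_sequentially funpow_add)
  have "\<Delta> ((f ^^ n) x) ((f ^^ (n + p)) x) \<le> \<epsilon>" if n: "n0 \<le> n" for n p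
  proof (induction p rule: less_induct)
    case (less p)
    show ?case
    proof (cases "p \<le> N")
      case True
      then show ?thesis using n0[OF n, of p] \<delta> by simp
    next
      case False
      let ?x = "\<lambda>i. (f ^^ i) x"
      have shift: "(f ^^ N) (?x i) = ?x (i + N)" for i
        by (simp add: add.commute funpow_add)
      have "\<Delta> (?x (n + N)) (?x (n + p)) \<le> (\<phi> ^^ k) (\<Delta> (?x n) (?x (n + (p - N))))"
        using \<Delta>_funpow_contraction[OF funpow_in funpow_in, OF x x, of k n "n + (p - N)"] False
        by (simp add: shift flip: N_def)
      also have "\<dots> \<le> (\<phi> ^^ k) \<epsilon>"
        using False \<open>0 < N\<close> x
        by (intro comparison_function_funpow_mono[OF comparison] \<Delta>_nonneg funpow_in less) auto
      finally have "\<Delta> (?x (n + N)) (?x (n + p)) \<le> \<delta>" using k by simp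
      moreover have "\<Delta> (?x n) (?x (n + N)) \<le> \<delta>" using n0[OF n, of N] by simp
      ultimately have "s * (\<Delta> (?x n) (?x (n + N)) + \<Delta> (?x (n + N)) (?x (n + p))) \<le> s * (\<delta> + \<delta>)"
        using const_ge_1 by (intro mult_left_mono add_mono) auto
      then show ?thesis
        using \<Delta>_triangle[OF funpow_in funpow_in funpow_in, OF x x x, of n "n + p" "n + N"] \<delta>(2)
        by simp
    qed
  qed
  then show ?thesis by blast
qed

lemma orbit_b_Cauchy:
  assumes x: "x \<in> X"
  shows "b_Cauchy X d (\<lambda>n. (f ^^ n) x)"
  unfolding b_Cauchy_def
proof (intro conjI allI impI)
  show "range (\<lambda>n. (f ^^ n) x) \<subseteq> X" using x funpow_in by auto
  fix \<epsilon> :: real assume "0 < \<epsilon>"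
  then obtain n0 where n0: "\<And>n p. n0 \<le> n \<Longrightarrow> \<Delta> ((f ^^ n) x) ((f ^^ (n + p)) x) \<le> \<epsilon> / 2"
    using orbit_Cauchy_\<Delta>[OF x, of "\<epsilon> / 2"] by auto
  \<comment> \<open>The estimate for \<open>\<Delta>\<close> covers ordered pairs of indices only;
    symmetry of \<open>d\<close> gives the rest.\<close>
  have le: "d ((f ^^ i) x) ((f ^^ j) x) < \<epsilon>" if "n0 \<le> i" "i \<le> j" for i j
    using n0[OF that(1), of "j - i"] that(2) d_le_\<Delta>[of "(f ^^ i) x" "(f ^^ j) x"] \<open>0 < \<epsilon>\<close> by simp
  have "d ((f ^^ i) x) ((f ^^ j) x) < \<epsilon>" if "n0 \<le> i" "n0 \<le> j" for i j
    using le[of i j] le[of j i] that commute[OF funpow_in funpow_in, OF x x, of i j]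
    by (cases "i \<le> j") auto
  then show "\<exists>N. \<forall>i\<ge>N. \<forall>j\<ge>N. d ((f ^^ i) x) ((f ^^ j) x) < \<epsilon>" by blast
qed

section \<open>Fixed points\<close>

lemma orbit_converges_to_fixed_point:
  assumes "x \<in> X" "\<alpha> \<in> X" "f \<alpha> = \<alpha>"
  shows "b_converges_to X d (\<lambda>n. (f ^^ n) x) \<alpha>"
proof -
  have fix_pow: "(f ^^ n) \<alpha> = \<alpha>" for n
    using assms(3) by (induction n) auto
  have "(\<lambda>n. \<Delta> ((f ^^ n) x) \<alpha>) \<longlonglongrightarrow> 0"
    using \<Delta>_orbits_tendsto[OF assms(1,2)] by (simp add: fix_pow)
  then have "(\<lambda>n. d ((f ^^ n) x) \<alpha>) \<longlonglongrightarrow> 0"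
    by (rule tendsto_sandwich[OF _ _ tendsto_const, rotated 2])
      (use assms in \<open>auto intro!: always_eventually d_le_\<Delta> nonneg funpow_in\<close>)
  then show ?thesis
    using assms by (auto simp: b_converges_to_def funpow_in)
qed

lemma Picard_operator:
  assumes "b_complete X d" "b_continuous X d f"
  shows "Picard_operator X d f"
proof -
  obtain x where x: "x \<in> X" using nonempty by blast
  obtain \<alpha> where \<alpha>: "b_converges_to X d (\<lambda>n. (f ^^ n) x) \<alpha>"
    using assms(1) orbit_b_Cauchy[OF x] by (auto simp: b_complete_def)
  \<comment> \<open>The shifted orbit tends to \<open>\<alpha>\<close> as a tail and to
    \<open>f \<alpha>\<close> by continuity.\<close>
  then have "b_converges_to X d (\<lambda>n. (f ^^ Suc n) x) \<alpha>"
    unfolding b_converges_to_def using LIMSEQ_Suc[of "\<lambda>n. d ((f ^^ n) x) \<alpha>"] by blast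
  moreover have "b_converges_to X d (\<lambda>n. (f ^^ Suc n) x) (f \<alpha>)"
    using assms(2) \<alpha> by (simp add: b_continuous_def)
  ultimately have "f \<alpha> = \<alpha>"
    by (rule b_converges_to_unique[symmetric])
  moreover have "\<alpha> \<in> X"
    using \<alpha> by (simp add: b_converges_to_def)
  ultimately have fixed: "\<alpha> \<in> X" "f \<alpha> = \<alpha>" by auto
  \<comment> \<open>The one orbit of \<open>x\<close> converges to every fixed point, so there is
    only one.\<close>
  have "\<beta> = \<alpha>" if "\<beta> \<in> X" "f \<beta> = \<beta>" for \<beta>
    using b_converges_to_unique[OF orbit_converges_to_fixed_point[OF x that] \<alpha>] .
  then show ?thesis
    unfolding Picard_operator_def using fixed orbit_converges_to_fixed_point[OF _ fixed] by blast
qed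

end

theorem theorem3p1:
  fixes X :: "'a set" and d :: "'a \<Rightarrow> 'a \<Rightarrow> real" and s :: real
    and f :: "'a \<Rightarrow> 'a" and m :: nat and \<phi> :: "real \<Rightarrow> real"
  assumes "b_metric_space X d s"
    and "b_complete X d"
    and "f \<in> X \<rightarrow> X"
    and "b_continuous X d f"
    and "1 \<le> m"
    and "comparison_function \<phi>"
    and "\<And>x y. x \<in> X \<Longrightarrow> y \<in> X \<Longrightarrow>
           d ((f ^^ m) x) ((f ^^ m) y) \<le> \<phi> (Max ((\<lambda>i. d ((f ^^ i) x) ((f ^^ i) y)) ` {..<m}))"
  shows "Picard_operator X d f"
proof -
  interpret b_max_contraction X d s f m \<phi>
    using assms by (simp add: b_max_contraction_def b_max_contraction_axioms_def)
  show ?thesis using assms by (intro Picard_operator)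
qed

end
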